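(* Let $d\ge 1$ and $1\le i\le k$ be integers. Let $A_{d,k,i}(n)$ denote the number of partitions of $n$ into parts $\not\equiv 0,\pm di \pmod{2dk+d}$. Let $B_{d,k,i}(n)$ denote the number of partitions of $n$ wherein (1) the integer $d$ appears as a part at most $i-1$ times; (2) for every integer $j\ge 1$, the total number of appearances of $dj$ and $dj+d$ (i.e. of any two consecutive multiples of $d$) together is at most $k-1$; and (3) nonmultiples of $d$ may appear as parts without restriction. Then $A_{d,k,i}(n)=B_{d,k,i}(n)$ for all $n\ge 0$.
   Context: A partition of $n$ is a finite multiset of positive integers (its parts) with sum $n$. *)

theory Defs
  imports "HOL-Library.Multiset" "HOL-Number_Theory.Cong"
begin

definition partitions :: "nat \<Rightarrow> nat multiset set" where
  "partitions n = {p. (\<forall>m \<in># p. m \<ge> 1) \<and> sum_mset p = n}"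

(* Finiteness makes the cardinalities below genuine counts. *)
lemma finite_partitions: "finite (partitions n)"
proof -
  have "partitions n \<subseteq> mset ` {xs. set xs \<subseteq> {..n} \<and> length xs \<le> n}"
  proof
    fix p assume "p \<in> partitions n"
    then have pos: "\<forall>m \<in># p. m \<ge> 1" and n: "sum_mset p = n"
      by (auto simp: partitions_def)
    obtain xs where xs: "p = mset xs" by (metis ex_mset)
    have len: "(\<forall>m \<in> set ys. m \<ge> 1) \<Longrightarrow> length ys \<le> sum_list ys" for ys :: "nat list"
      by (induction ys) auto
    have "sum_list xs = n" using n xs by (simp add: sum_mset_sum_list)
    moreover have "length xs \<le> sum_list xs" using pos xs len[of xs] by simp
    moreover have "set xs \<subseteq> {..sum_list xs}" by (auto intro: member_le_sum_list)
    ultimately show "p \<in> mset ` {xs. set xs \<subseteq> {..n} \<and> length xs \<le> n}"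
      using xs by auto
  qed
  then show ?thesis
    using finite_lists_length_le[of "{..n}" n] by (meson finite_atMost finite_imageI finite_subset)
qed

(* Congruences are taken over the integers because of the residue - d i. *)
definition A_count :: "nat \<Rightarrow> nat \<Rightarrow> nat \<Rightarrow> nat \<Rightarrow> nat" where
  "A_count d k i n = card {p \<in> partitions n. \<forall>m \<in># p.
     \<not> [int m = 0] (mod int (2 * d * k + d)) \<and>
     \<not> [int m = int (d * i)] (mod int (2 * d * k + d)) \<and>
     \<not> [int m = - int (d * i)] (mod int (2 * d * k + d))}"

(* Parts that are not multiples of d are unrestricted, so they impose no conjunct. *)
definition B_count :: "nat \<Rightarrow> nat \<Rightarrow> nat \<Rightarrow> nat \<Rightarrow> nat" where
  "B_count d k i n = card {p \<in> partitions n.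
     count p d \<le> i - 1 \<and>
     (\<forall>j \<ge> 1. count p (d * j) + count p (d * j + d) \<le> k - 1)}"

end

theory Submission
  imports Defs "HOL-Computational_Algebra.Formal_Power_Series"
begin

text \<open>
  The conditions on both sides concern only the parts that are multiples of \<open>d\<close>, and after
  division by \<open>d\<close> they become the two conditions for \<open>d = 1\<close>. Splitting a partition into its
  nonmultiples and its multiples of \<open>d\<close> (\<open>card_quotient_decomposition\<close>) therefore reduces the
  claim to \<open>d = 1\<close>, which is Gordon's generalization of the Rogers-Ramanujan identities (\<open>gordon_theorem\<close>).

  Gordon's theorem is proved by generating functions in one variable \<open>X\<close>. For a threshold \<open>N\<close>, let
  \<open>F i N\<close> count the Gordon partitions all of whose parts exceed \<open>N\<close> and in which the least admissible
  part \<open>N + 1\<close> occurs fewer than \<open>i\<close> times. If \<open>N + 1\<close> occurs exactly \<open>i\<close> times, then \<open>N + 2\<close> occurs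
  fewer than \<open>k - i\<close> times; removing the copies of \<open>N + 1\<close> gives
  \<open>F (i + 1) N = F i N + X ^ (i * (N + 1)) * F (k - i) (N + 1)\<close>.
  This is Andrews' recurrence for his functions \<open>J\<close>, with his second variable specialized to the
  powers \<open>X ^ N\<close>. Modulo a fixed power of \<open>X\<close> everything is trivial once \<open>N\<close> is large, so the
  recurrence has only one solution, by descending induction on \<open>N\<close> (\<open>gordon_gf_agree\<close>).
  An alternating sum, \<open>gordon_term\<close> summed over \<open>n\<close> and divided by \<open>(1 - X) * (1 - X\<^sup>2) * \<dots>\<close>,
  satisfies it too, by telescoping (\<open>gordon_sum_Suc\<close>), and hence equals \<open>F\<close>.

  At \<open>N = 0\<close> the alternating sum is a theta series. Jacobi's triple product turns it into the product
  of \<open>1 - X ^ s\<close> over the residues excluded modulo \<open>2 * k + 1\<close>, and division by the product over all \<open>s\<close>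
  leaves the generating function of the partitions into the residues that remain. The triple product
  is obtained from its finite form, a rearranged \<open>q\<close>-binomial theorem.

  All infinite sums and products are replaced by finite ones that have the same coefficients below a
  bound \<open>M\<close>, so that no limits of power series are involved.
\<close>

section \<open>Power series modulo a power of the variable\<close>

unbundle fps_syntax

definition agree :: "nat \<Rightarrow> 'a::comm_ring_1 fps \<Rightarrow> 'a fps \<Rightarrow> bool" where
  "agree M f g \<longleftrightarrow> (\<forall>n<M. f $ n = g $ n)"

lemma agree_refl [simp]: "agree M f f"
  by (simp add: agree_def)

lemma agree_sym: "agree M f g \<Longrightarrow> agree M g f"
  by (simp add: agree_def)

lemma agree_trans [trans]: "agree M f g \<Longrightarrow> agree M g h \<Longrightarrow> agree M f h"
  by (simp add: agree_def)

lemma agree_mono: "agree M f g \<Longrightarrow> K \<le> M \<Longrightarrow> agree K f g"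
  by (simp add: agree_def)

lemma agree_add: "agree M f g \<Longrightarrow> agree M f' g' \<Longrightarrow> agree M (f + f') (g + g')"
  by (simp add: agree_def)

lemma agree_diff: "agree M f g \<Longrightarrow> agree M f' g' \<Longrightarrow> agree M (f - f') (g - g')"
  by (simp add: agree_def)

lemma agree_mult: "agree M f g \<Longrightarrow> agree M f' g' \<Longrightarrow> agree M (f * f') (g * g')"
  by (auto simp: agree_def fps_mult_nth intro!: sum.cong)

lemma agree_sum: "(\<And>x. x \<in> A \<Longrightarrow> agree M (f x) (g x)) \<Longrightarrow> agree M (sum f A) (sum g A)"
  by (auto simp: agree_def fps_sum_nth intro!: sum.cong)

lemma agree_X_power_mult_0: "M \<le> e \<Longrightarrow> agree M (fps_X ^ e * f) 0"
  by (simp add: agree_def fps_X_power_mult_nth)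

text \<open>
  A factor \<open>X ^ e\<close> improves the precision by \<open>e\<close>. This is what makes the terms of the triple product
  with few correct factors harmless: they carry high powers of \<open>X\<close>.
\<close>

lemma agree_X_power_mult:
  "agree M f g \<Longrightarrow> agree (e + M) (fps_X ^ e * f) (fps_X ^ e * g)"
  by (auto simp: agree_def fps_X_power_mult_nth)

lemma agree_cancel:
  fixes c :: "'a::field fps"
  assumes "agree M (c * f) (c * g)" and "c $ 0 \<noteq> 0"
  shows "agree M f g"
proof -
  have "agree M (inverse c * (c * f)) (inverse c * (c * g))"
    using assms(1) by (rule agree_mult[OF agree_refl])
  moreover have "inverse c * (c * h) = h" for h
    using inverse_mult_eq_1[OF assms(2)] by (simp add: mult.assoc[symmetric])
  ultimately show ?thesis by (simp only:)
qed

lemma agree_prod_one_minus_X_power: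
  fixes e :: "'b \<Rightarrow> nat"
  assumes "finite A" and "B \<subseteq> A" and "\<And>r. r \<in> A - B \<Longrightarrow> M \<le> e r"
  shows "agree M (\<Prod>r\<in>A. 1 - fps_X ^ e r) (\<Prod>r\<in>B. 1 - fps_X ^ e r :: 'a::comm_ring_1 fps)"
proof -
  have "agree M (\<Prod>r\<in>C. 1 - fps_X ^ e r) (1 :: 'a fps)"
    if "finite C" "\<And>r. r \<in> C \<Longrightarrow> M \<le> e r" for C
    using that
  proof (induction C)
    case (insert x C)
    have "agree M (fps_X ^ e x * 1) (0 :: 'a fps)"
      using insert.prems by (intro agree_X_power_mult_0) auto
    then have "agree M (1 - fps_X ^ e x) (1 - 0 :: 'a fps)"
      by (intro agree_diff) auto
    then have "agree M ((1 - fps_X ^ e x) * (\<Prod>r\<in>C. 1 - fps_X ^ e r)) ((1 - 0) * 1 :: 'a fps)"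
      using insert by (intro agree_mult) auto
    then show ?case using insert.hyps by simp
  qed simp
  from this[of "A - B"] assms
  have "agree M ((\<Prod>r\<in>A - B. 1 - fps_X ^ e r) * (\<Prod>r\<in>B. 1 - fps_X ^ e r))
          (1 * (\<Prod>r\<in>B. 1 - fps_X ^ e r :: 'a fps))"
    by (intro agree_mult) auto
  then show ?thesis
    using prod.subset_diff[OF assms(2,1), of "\<lambda>r. 1 - fps_X ^ e r :: 'a fps"] by simp
qed

lemma prod_one_minus_X_power_nth_0:
  assumes "\<And>r. r \<in> A \<Longrightarrow> 0 < e r"
  shows "(\<Prod>r\<in>A. 1 - fps_X ^ e r :: 'a::comm_ring_1 fps) $ 0 = 1"
  using assms by (induction A rule: infinite_finite_induct) auto

section \<open>The finite Jacobi triple product\<close>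

fun gauss_binomial :: "'a::comm_ring_1 \<Rightarrow> nat \<Rightarrow> nat \<Rightarrow> 'a" where
  "gauss_binomial q n 0 = 1"
| "gauss_binomial q 0 (Suc j) = 0"
| "gauss_binomial q (Suc n) (Suc j) = q ^ Suc j * gauss_binomial q n (Suc j) + gauss_binomial q n j"

text \<open>
  The \<open>q\<close>-Pochhammer symbol \<open>(q; q)\<^sub>n\<close>, not the \<open>q\<close>-factorial normalized by powers of \<open>1 - q\<close>.
\<close>

definition q_fact :: "'a::comm_ring_1 \<Rightarrow> nat \<Rightarrow> 'a" where
  "q_fact q n = (\<Prod>r\<in>{1..n}. 1 - q ^ r)"

lemma q_fact_0 [simp]: "q_fact q 0 = 1"
  by (simp add: q_fact_def)

lemma q_fact_Suc: "q_fact q (Suc n) = q_fact q n * (1 - q ^ Suc n)"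
  by (simp add: q_fact_def)

lemma gauss_binomial_eq_0: "n < j \<Longrightarrow> gauss_binomial q n j = 0"
  by (induction q n j rule: gauss_binomial.induct) auto

lemma gauss_binomial_self: "gauss_binomial q n n = 1"
  by (induction n) (auto simp: gauss_binomial_eq_0)

text \<open>
  The quotient formula for Gaussian binomials, without division so that it holds in any commutative
  ring. The recursion reproduces it because
  \<open>q ^ j * (1 - q ^ n) + (1 - q ^ j) = 1 - q ^ (n + j)\<close>.
\<close>

lemma gauss_binomial_q_fact:
  "gauss_binomial q (n + j) j * (q_fact q j * q_fact q n) = q_fact q (n + j)"
proof (induction "n + j" arbitrary: n j)
  case (Suc s)
  show ?case
  proof (cases n; cases j)
    fix n' j' assume n: "n = Suc n'" and j: "j = Suc j'"
    have 1: "gauss_binomial q (n' + j) j * (q_fact q j * q_fact q n') = q_fact q (n' + j)"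
      using Suc n by auto
    have 2: "gauss_binomial q (n' + j) j' * (q_fact q j' * q_fact q n) = q_fact q (n' + j)"
      using Suc.hyps(1)[of n j'] Suc.hyps(2) n j by auto
    have "gauss_binomial q (n + j) j * (q_fact q j * q_fact q n)
        = (q ^ j * gauss_binomial q (n' + j) j + gauss_binomial q (n' + j) j')
            * (q_fact q j * q_fact q n)"
      by (simp add: n j)
    also have "\<dots> = q ^ j * (1 - q ^ n) * (gauss_binomial q (n' + j) j * (q_fact q j * q_fact q n'))
        + (1 - q ^ j) * (gauss_binomial q (n' + j) j' * (q_fact q j' * q_fact q n))"
      unfolding q_fact_Suc[of q n', folded n] q_fact_Suc[of q j', folded j]
      by (simp only: distrib_left distrib_right mult_ac)
    also have "\<dots> = q_fact q (n' + j) * (1 - q ^ (n + j))"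
      unfolding 1 2 by (simp add: algebra_simps power_add)
    also have "\<dots> = q_fact q (n + j)"
      using q_fact_Suc[of q "n' + j"] by (simp add: n)
    finally show ?thesis .
  qed (auto simp: gauss_binomial_self)
qed simp

text \<open>
  Splitting off the first factor replaces \<open>z\<close> by \<open>z * q\<close> in the others; this is why the induction
  varies \<open>z\<close>. The homogeneous form in \<open>y\<close> and \<open>z\<close> allows \<open>y\<close> to be a power of \<open>q\<close> below, where the
  usual form would need a negative power.
\<close>

lemma q_binomial_theorem:
  fixes q y z :: "'a::comm_ring_1"
  shows "(\<Prod>j<n. y + z * q ^ j)
    = (\<Sum>j\<le>n. gauss_binomial q n j * q ^ (j choose 2) * z ^ j * y ^ (n - j))"
proof (induction n arbitrary: z)
  case (Suc n)
  let ?g = "gauss_binomial q"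
  have "(\<Prod>j<Suc n. y + z * q ^ j) = (y + z) * (\<Prod>j<n. y + (z * q) * q ^ j)"
    by (subst prod.lessThan_Suc_shift) (simp add: mult.assoc)
  also have "\<dots> = y * (\<Sum>j\<le>n. ?g n j * q ^ (j choose 2) * (z * q) ^ j * y ^ (n - j))
      + z * (\<Sum>j\<le>n. ?g n j * q ^ (j choose 2) * (z * q) ^ j * y ^ (n - j))"
    unfolding Suc.IH by (simp add: algebra_simps)
  also have "y * (\<Sum>j\<le>n. ?g n j * q ^ (j choose 2) * (z * q) ^ j * y ^ (n - j))
      = (\<Sum>j\<le>Suc n. ?g n j * q ^ (j choose 2) * (z * q) ^ j * y ^ (Suc n - j))"
    by (simp add: sum_distrib_left gauss_binomial_eq_0 Suc_diff_le algebra_simps)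
  also have "\<dots> = y ^ Suc n
      + (\<Sum>j\<le>n. ?g n (Suc j) * q ^ (Suc j choose 2) * (z * q) ^ Suc j * y ^ (n - j))"
    by (subst sum.atMost_Suc_shift) (simp add: binomial_eq_0)
  also have "z * (\<Sum>j\<le>n. ?g n j * q ^ (j choose 2) * (z * q) ^ j * y ^ (n - j))
      = (\<Sum>j\<le>n. ?g n j * q ^ (Suc j choose 2) * z ^ Suc j * y ^ (n - j))"
    by (simp add: sum_distrib_left power_add power_mult_distrib numeral_2_eq_2 algebra_simps)
  also have "y ^ Suc n
      + (\<Sum>j\<le>n. ?g n (Suc j) * q ^ (Suc j choose 2) * (z * q) ^ Suc j * y ^ (n - j))
      + (\<Sum>j\<le>n. ?g n j * q ^ (Suc j choose 2) * z ^ Suc j * y ^ (n - j))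
    = y ^ Suc n + (\<Sum>j\<le>n. ?g (Suc n) (Suc j) * q ^ (Suc j choose 2) * z ^ Suc j * y ^ (n - j))"
    unfolding add.assoc sum.distrib[symmetric]
    by (intro arg_cong2[of _ _ _ _ "(+)"] sum.cong refl) (simp add: algebra_simps power_mult_distrib)
  also have "\<dots> = (\<Sum>j\<le>Suc n. ?g (Suc n) j * q ^ (j choose 2) * z ^ j * y ^ (Suc n - j))"
    by (subst sum.atMost_Suc_shift) (simp add: binomial_eq_0)
  finally show ?case .
qed (simp add: binomial_eq_0)

text \<open>
  The \<open>q\<close>-binomial theorem for \<open>2 * n\<close> factors \<open>q ^ n - z * q ^ j\<close>. The upper \<open>n\<close> factors are
  multiples of \<open>1 - z * q ^ (j - n)\<close>, and the lower \<open>n\<close>, because \<open>q = z * w\<close>, of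
  \<open>1 - w * q ^ (n - 1 - j)\<close>; the common monomial \<open>c\<close> then cancels. Here \<open>w\<close> stands for \<open>q / z\<close>, which
  keeps all exponents nonnegative: the terms of negative index of the usual two-sided sum form the
  second sum.
\<close>

lemma finite_jacobi_triple_product:
  fixes q z w :: "'a::idom"
  assumes zw: "z * w = q" and "q \<noteq> 0"
  shows "(\<Prod>j<n. 1 - z * q ^ j) * (\<Prod>j<n. 1 - w * q ^ j)
    = (\<Sum>j\<le>n. (-1) ^ j * gauss_binomial q (2 * n) (n + j) * (q ^ (j choose 2) * z ^ j))
    + (\<Sum>j\<in>{1..n}. (-1) ^ j * gauss_binomial q (2 * n) (n - j) * (q ^ (j choose 2) * w ^ j))"
    (is "?L = ?R1 + ?R2")
proof -
  let ?g = "gauss_binomial q (2 * n)"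
  \<comment> \<open>The monomial produced by extracting \<open>q ^ n\<close> from the upper factors and
    \<open>- z * q ^ j\<close> from the lower ones.\<close>
  define c where "c = (-1) ^ n * z ^ n * q ^ ((n choose 2) + n * n)"
  have "c \<noteq> 0" using assms by (auto simp: c_def)
  have tri: "(Suc j choose 2) = (j choose 2) + j" for j
    by (simp add: numeral_2_eq_2)
  have tri_add: "((a + b) choose 2) = (a choose 2) + a * b + (b choose 2)" for a b :: nat
    by (induction b) (auto simp: tri)
  have prod_q: "(\<Prod>j<n. q ^ j) = q ^ (n choose 2)" for n
    by (induction n) (auto simp: tri power_add binomial_eq_0)
  have prod_split: "(\<Prod>j<a + b. f j) = (\<Prod>j<a. f j) * (\<Prod>j<b. f (a + j))"
    for f :: "nat \<Rightarrow> 'a" and a b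
    by (induction b) (auto simp: mult.assoc)
  have "(\<Prod>j<2*n. q ^ n + (- z) * q ^ j)
      = (\<Prod>j<n. q ^ n + (- z) * q ^ j) * (\<Prod>j<n. q ^ n + (- z) * q ^ (n + j))"
    using prod_split[of "\<lambda>j. q ^ n + (- z) * q ^ j" n n] by (simp only: mult_2)
  also have "(\<Prod>j<n. q ^ n + (- z) * q ^ (n + j)) = (\<Prod>j<n. q ^ n * (1 - z * q ^ j))"
    by (intro prod.cong) (auto simp: algebra_simps power_add)
  also have "\<dots> = q ^ (n * n) * (\<Prod>j<n. 1 - z * q ^ j)"
    by (simp add: prod.distrib power_mult)
  also have "(\<Prod>j<n. q ^ n + (- z) * q ^ j) = (\<Prod>j<n. (- z) * q ^ j * (1 - w * q ^ (n - Suc j)))"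
  proof (intro prod.cong refl)
    fix j assume "j \<in> {..<n}"
    then have "n = Suc (j + (n - Suc j))" by simp
    then have "q ^ n = q * (q ^ j * q ^ (n - Suc j))" by (metis power_Suc power_add)
    then show "q ^ n + (- z) * q ^ j = (- z) * q ^ j * (1 - w * q ^ (n - Suc j))"
      using zw by (simp add: algebra_simps)
  qed
  also have "\<dots> = (- z) ^ n * q ^ (n choose 2) * (\<Prod>j<n. 1 - w * q ^ j)"
    by (simp only: prod.distrib prod_q prod_constant card_lessThan
        prod.nat_diff_reindex[of "\<lambda>j. 1 - w * q ^ j" n])
  finally have L: "(\<Prod>j<2*n. q ^ n + (- z) * q ^ j) = c * ?L"
    by (simp add: c_def power_add power_minus[of z] algebra_simps)
  have "(\<Prod>j<2*n. q ^ n + (- z) * q ^ j)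
      = (\<Sum>t\<le>2*n. ?g t * q ^ (t choose 2) * (- z) ^ t * (q ^ n) ^ (2 * n - t))"
    by (rule q_binomial_theorem)
  also have "{..2*n} = (\<lambda>j. n + j) ` {..n} \<union> (\<lambda>j. n - j) ` {1..n}"
  proof (intro equalityI subsetI)
    fix t assume "t \<in> {..2*n}"
    then show "t \<in> (\<lambda>j. n + j) ` {..n} \<union> (\<lambda>j. n - j) ` {1..n}"
      by (cases "n \<le> t") (auto intro: image_eqI[of _ _ "t - n"] image_eqI[of _ _ "n - t"])
  qed auto
  also have "(\<Sum>t\<in>\<dots>. ?g t * q ^ (t choose 2) * (- z) ^ t * (q ^ n) ^ (2 * n - t))
     = (\<Sum>j\<le>n. ?g (n + j) * q ^ ((n + j) choose 2) * (- z) ^ (n + j) * (q ^ n) ^ (n - j))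
     + (\<Sum>j\<in>{1..n}. ?g (n - j) * q ^ ((n - j) choose 2) * (- z) ^ (n - j) * (q ^ n) ^ (n + j))"
  proof -
    have "inj_on (\<lambda>j. n + j) {..n}" "inj_on (\<lambda>j. n - j) {1..n}"
      by (auto simp: inj_on_def)
    moreover have "2 * n - (n + j) = n - j" for j by simp
    moreover have "2 * n - (n - j) = n + j" if "j \<in> {1..n}" for j using that by simp
    ultimately show ?thesis
      by (subst sum.union_disjoint) (auto simp only: sum.reindex comp_def finite_imageI finite_atMost
          finite_atLeastAtMost cong: sum.cong, auto)
  qed
  also have "(\<Sum>j\<le>n. ?g (n + j) * q ^ ((n + j) choose 2) * (- z) ^ (n + j) * (q ^ n) ^ (n - j)) = c * ?R1"
    unfolding sum_distrib_left
  proof (intro sum.cong refl)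
    fix j assume "j \<in> {..n}"
    then obtain r where r: "n = j + r" by (auto simp: le_iff_add)
    have "((n + j) choose 2) + n * (n - j) = (n choose 2) + n * n + (j choose 2)"
      by (simp add: tri_add r algebra_simps)
    then have "q ^ ((n + j) choose 2) * (q ^ n) ^ (n - j) = q ^ ((n choose 2) + n * n) * q ^ (j choose 2)"
      by (simp flip: power_mult power_add)
    then show "?g (n + j) * q ^ ((n + j) choose 2) * (- z) ^ (n + j) * (q ^ n) ^ (n - j)
        = c * ((-1) ^ j * ?g (n + j) * (q ^ (j choose 2) * z ^ j))"
      by (simp add: c_def power_minus[of z] power_add[of _ n j] mult_ac)
  qed
  also have "(\<Sum>j\<in>{1..n}. ?g (n - j) * q ^ ((n - j) choose 2) * (- z) ^ (n - j) * (q ^ n) ^ (n + j)) = c * ?R2"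
    unfolding sum_distrib_left
  proof (intro sum.cong refl)
    fix j assume "j \<in> {1..n}"
    then obtain r where r: "n = j + r" by (auto simp: le_iff_add)
    have jj: "2 * (j choose 2) + j = j * j"
      by (induction j) (auto simp: tri)
    have "((n - j) choose 2) + n * (n + j) = (n choose 2) + n * n + (j choose 2) + j"
      using jj by (simp add: tri_add r algebra_simps)
    then have "q ^ ((n - j) choose 2) * (q ^ n) ^ (n + j)
        = q ^ ((n choose 2) + n * n) * q ^ (j choose 2) * q ^ j"
      by (simp flip: power_mult power_add)
    also have "q ^ j = z ^ j * w ^ j"
      by (simp flip: zw power_mult_distrib)
    finally have q: "q ^ ((n - j) choose 2) * (q ^ n) ^ (n + j)
        = q ^ ((n choose 2) + n * n) * q ^ (j choose 2) * (z ^ j * w ^ j)" .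
    have z: "z ^ (n - j) * z ^ j = z ^ n" by (simp add: r power_add)
    have sgn: "(-1) ^ (n - j) = (-1) ^ n * (-1 :: 'a) ^ j" by (simp add: r power_add)
    have "?g (n - j) * q ^ ((n - j) choose 2) * (- z) ^ (n - j) * (q ^ n) ^ (n + j)
       = ?g (n - j) * ((-1) ^ (n - j) * z ^ (n - j)) * (q ^ ((n - j) choose 2) * (q ^ n) ^ (n + j))"
      by (simp add: power_minus[of z] mult_ac)
    also have "\<dots> = ?g (n - j) * (-1) ^ n * (-1) ^ j * (z ^ (n - j) * z ^ j)
         * q ^ ((n choose 2) + n * n) * q ^ (j choose 2) * w ^ j"
      unfolding q sgn by (simp add: mult_ac)
    finally show "?g (n - j) * q ^ ((n - j) choose 2) * (- z) ^ (n - j) * (q ^ n) ^ (n + j)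
        = c * ((-1) ^ j * ?g (n - j) * (q ^ (j choose 2) * w ^ j))"
      unfolding z by (simp add: c_def mult_ac)
  qed
  finally have "c * ?L = c * (?R1 + ?R2)"
    unfolding L by (simp add: distrib_left)
  then show ?thesis using \<open>c \<noteq> 0\<close> by simp
qed

lemma q_fact_X_power:
  "q_fact (fps_X ^ m) n = (\<Prod>r\<in>{1..n}. 1 - fps_X ^ (m * r) :: 'a::comm_ring_1 fps)"
  by (simp add: q_fact_def power_mult)

lemma q_fact_X_power_agree:
  assumes "1 \<le> m" and "L \<le> n" and "L \<le> n'"
  shows "agree (Suc L) (q_fact (fps_X ^ m) n) (q_fact (fps_X ^ m) n' :: 'a::comm_ring_1 fps)"
proof -
  have *: "agree (Suc L) (q_fact (fps_X ^ m) a) (q_fact (fps_X ^ m) L :: 'a fps)" if "L \<le> a" for a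
    unfolding q_fact_X_power
  proof (rule agree_prod_one_minus_X_power)
    fix r assume "r \<in> {1..a} - {1..L}"
    then have "Suc L \<le> 1 * r" by auto
    also have "\<dots> \<le> m * r" using assms(1) by (rule mult_le_mono1)
    finally show "Suc L \<le> m * r" .
  qed (use that in auto)
  show ?thesis using *[OF assms(2)] *[OF assms(3)] by (blast intro: agree_trans agree_sym)
qed

text \<open>
  As \<open>a\<close> and \<open>b\<close> grow, the Gaussian binomial tends to \<open>1 / (Q; Q)\<^sub>\<infinity>\<close>: all \<open>q_fact Q\<close> with index at
  least \<open>L\<close> agree below \<open>X ^ (L + 1)\<close>, so the quotient formula collapses.
\<close>

lemma q_fact_gauss_binomial_agree:
  fixes m :: nat
  assumes "1 \<le> m" and "L \<le> a" and "L \<le> b" and "L \<le> n"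
  defines "Q \<equiv> fps_X ^ m :: 'a::field fps"
  shows "agree (Suc L) (q_fact Q n * gauss_binomial Q (a + b) b) 1"
proof (rule agree_cancel)
  have q: "agree (Suc L) (q_fact Q c) (q_fact Q d)" if "L \<le> c" "L \<le> d" for c d
    unfolding Q_def using assms(1) that by (rule q_fact_X_power_agree)
  have "q_fact Q L * (q_fact Q n * gauss_binomial Q (a + b) b)
      = gauss_binomial Q (a + b) b * (q_fact Q L * q_fact Q n)"
    by (simp only: mult_ac)
  also have "agree (Suc L) \<dots> (gauss_binomial Q (a + b) b * (q_fact Q b * q_fact Q a))"
    using assms by (intro agree_mult q agree_refl) auto
  also have "gauss_binomial Q (a + b) b * (q_fact Q b * q_fact Q a) = q_fact Q (a + b)"
    by (rule gauss_binomial_q_fact)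
  also have "agree (Suc L) \<dots> (q_fact Q L * 1)"
    using assms q[of "a + b" L] by simp
  finally show "agree (Suc L) (q_fact Q L * (q_fact Q n * gauss_binomial Q (a + b) b)) (q_fact Q L * 1)" .
  have "q_fact Q L $ 0 = 1"
    unfolding Q_def q_fact_X_power using assms(1) by (intro prod_one_minus_X_power_nth_0) auto
  then show "q_fact Q L $ 0 \<noteq> 0" by simp
qed

text \<open>
  In the finite triple product of order \<open>M\<close>, the Gaussian binomial of index \<open>j\<close> times \<open>q_fact Q M\<close>
  is known to agree with \<open>1\<close> below \<open>X ^ (M - j + 1)\<close>. It is multiplied by \<open>Q ^ (j choose 2)\<close>, and \<open>(j choose 2) + 1 \<ge> j\<close> restores the
  precision \<open>M\<close>. The right-hand side pairs the term \<open>j\<close> of the first sum with the term \<open>j + 1\<close>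
  of the second; the term \<open>M\<close> of the first sum has no partner, and is negligible because \<open>a \<ge> 1\<close>.
\<close>

lemma jacobi_triple_product_agree:
  fixes a b :: nat
  assumes "1 \<le> a"
  defines "Q \<equiv> fps_X ^ (a + b) :: 'a::field fps"
  shows "agree M
    (q_fact Q M * ((\<Prod>j<M. 1 - fps_X ^ a * Q ^ j) * (\<Prod>j<M. 1 - fps_X ^ b * Q ^ j)))
    (\<Sum>j<M. (-1) ^ j * (Q ^ (j choose 2) * (fps_X ^ a) ^ j - Q ^ (Suc j choose 2) * (fps_X ^ b) ^ Suc j))"
proof -
  let ?z = "fps_X ^ a :: 'a fps" and ?w = "fps_X ^ b :: 'a fps"
  let ?g = "gauss_binomial Q (2 * M)"
  have tri: "j \<le> Suc (j choose 2)" for j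
  proof (induction j)
    case (Suc j)
    then show ?case by (cases j) (auto simp: numeral_2_eq_2)
  qed simp
  have coeff: "agree M (q_fact Q M * ((-1) ^ j * ?g t * (Q ^ (j choose 2) * fps_X ^ c)))
                 ((-1) ^ j * (Q ^ (j choose 2) * fps_X ^ c))"
    if "t = M + j \<or> t = M - j" "j \<le> M" for j t c
  proof -
    have t: "2 * M = (2 * M - t) + t" "M - j \<le> 2 * M - t" "M - j \<le> t" using that by auto
    have "agree (Suc (M - j)) (q_fact Q M * ?g t) 1"
      unfolding Q_def by (subst t(1), rule q_fact_gauss_binomial_agree) (use assms(1) t(2,3) in auto)
    then have "agree ((a + b) * (j choose 2) + Suc (M - j))
        (fps_X ^ ((a + b) * (j choose 2)) * (q_fact Q M * ?g t)) (fps_X ^ ((a + b) * (j choose 2)) * 1)"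
      by (rule agree_X_power_mult)
    moreover have "M \<le> (a + b) * (j choose 2) + Suc (M - j)"
    proof -
      have "1 * (j choose 2) \<le> (a + b) * (j choose 2)" using assms(1) by (intro mult_le_mono1) auto
      then show ?thesis using tri[of j] by linarith
    qed
    ultimately have "agree M (Q ^ (j choose 2) * (q_fact Q M * ?g t)) (Q ^ (j choose 2) * 1)"
      unfolding Q_def power_mult by (rule agree_mono)
    then have "agree M ((-1) ^ j * fps_X ^ c * (Q ^ (j choose 2) * (q_fact Q M * ?g t)))
        ((-1) ^ j * fps_X ^ c * (Q ^ (j choose 2) * 1))"
      by (rule agree_mult[OF agree_refl])
    then show ?thesis by (simp add: mult_ac)
  qed
  have "(\<Prod>j<M. 1 - ?z * Q ^ j) * (\<Prod>j<M. 1 - ?w * Q ^ j)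
     = (\<Sum>j\<le>M. (-1) ^ j * ?g (M + j) * (Q ^ (j choose 2) * ?z ^ j))
     + (\<Sum>j\<in>{1..M}. (-1) ^ j * ?g (M - j) * (Q ^ (j choose 2) * ?w ^ j))"
    by (rule finite_jacobi_triple_product) (auto simp: Q_def power_add)
  then have expand: "q_fact Q M * ((\<Prod>j<M. 1 - ?z * Q ^ j) * (\<Prod>j<M. 1 - ?w * Q ^ j))
     = (\<Sum>j\<le>M. q_fact Q M * ((-1) ^ j * ?g (M + j) * (Q ^ (j choose 2) * ?z ^ j)))
     + (\<Sum>j\<in>{1..M}. q_fact Q M * ((-1) ^ j * ?g (M - j) * (Q ^ (j choose 2) * ?w ^ j)))"
    by (simp only: distrib_left sum_distrib_left)
  have upper: "agree M (\<Sum>j\<le>M. q_fact Q M * ((-1) ^ j * ?g (M + j) * (Q ^ (j choose 2) * ?z ^ j)))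
      (\<Sum>j\<le>M. (-1) ^ j * (Q ^ (j choose 2) * ?z ^ j))"
    by (rule agree_sum, unfold power_mult[symmetric], rule coeff) auto
  have lower: "agree M (\<Sum>j\<in>{1..M}. q_fact Q M * ((-1) ^ j * ?g (M - j) * (Q ^ (j choose 2) * ?w ^ j)))
      (\<Sum>j\<in>{1..M}. (-1) ^ j * (Q ^ (j choose 2) * ?w ^ j))"
    by (rule agree_sum, unfold power_mult[symmetric], rule coeff) auto
  have z: "(\<Sum>j\<le>M. (-1) ^ j * (Q ^ (j choose 2) * ?z ^ j))
      = (\<Sum>j<M. (-1) ^ j * (Q ^ (j choose 2) * ?z ^ j)) + fps_X ^ (a * M) * ((-1) ^ M * Q ^ (M choose 2))"
    by (simp add: lessThan_Suc_atMost[symmetric] power_mult[symmetric] mult_ac)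
  have w: "(\<Sum>j\<in>{1..M}. (-1) ^ j * (Q ^ (j choose 2) * ?w ^ j))
      = - (\<Sum>j<M. (-1) ^ j * (Q ^ (Suc j choose 2) * ?w ^ Suc j))"
  proof -
    have "{1..M} = Suc ` {..<M}"
      by (simp add: lessThan_atLeast0 atLeastLessThanSuc_atLeastAtMost)
    then show ?thesis by (simp add: sum.reindex sum_negf)
  qed
  have "agree M (fps_X ^ (a * M) * ((-1) ^ M * Q ^ (M choose 2))) 0"
    using assms(1) by (intro agree_X_power_mult_0) simp
  from agree_add[OF agree_add[OF agree_refl this] agree_refl] have
    "agree M ((\<Sum>j\<le>M. (-1) ^ j * (Q ^ (j choose 2) * ?z ^ j))
        + (\<Sum>j\<in>{1..M}. (-1) ^ j * (Q ^ (j choose 2) * ?w ^ j)))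
      ((\<Sum>j<M. (-1) ^ j * (Q ^ (j choose 2) * ?z ^ j)) + 0
        + - (\<Sum>j<M. (-1) ^ j * (Q ^ (Suc j choose 2) * ?w ^ Suc j)))"
    unfolding z w .
  from agree_trans[OF agree_add[OF upper lower] this] show ?thesis
    unfolding expand by (simp only: add_0_right right_diff_distrib sum_subtractf diff_conv_add_uminus[symmetric])
qed

section \<open>Partitions with parts in a given set\<close>

definition partition_gf :: "nat set \<Rightarrow> 'a::comm_ring_1 fps" where
  "partition_gf S = Abs_fps (\<lambda>n. of_nat (card {p \<in> partitions n. set_mset p \<subseteq> S}))"

text \<open>
  Partitions that contain \<open>s\<close> correspond to arbitrary ones of \<open>n - s\<close>, by removing one copy of \<open>s\<close>.
\<close>

lemma partition_gf_insert:
  assumes "s \<notin> S" and "1 \<le> s"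
  shows "partition_gf (insert s S) * (1 - fps_X ^ s) = (partition_gf S :: 'a::comm_ring_1 fps)"
proof (rule fps_ext)
  fix n
  let ?P = "\<lambda>S n. {p \<in> partitions n. set_mset p \<subseteq> S}"
  have fin: "finite (?P S n)" for S n by (simp add: finite_partitions)
  have split: "?P (insert s S) n = ?P S n \<union> (if s \<le> n then add_mset s ` ?P (insert s S) (n - s) else {})"
  proof (intro equalityI subsetI)
    fix p assume p: "p \<in> ?P (insert s S) n"
    show "p \<in> ?P S n \<union> (if s \<le> n then add_mset s ` ?P (insert s S) (n - s) else {})"
    proof (cases "s \<in># p")
      case True
      then obtain p' where "p = add_mset s p'" by (metis insert_DiffM)
      with p show ?thesis by (auto simp: partitions_def)
    qed (use p in auto)
  next
    fix p assume "p \<in> ?P S n \<union> (if s \<le> n then add_mset s ` ?P (insert s S) (n - s) else {})"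
    then show "p \<in> ?P (insert s S) n"
      using assms(2) by (auto simp: partitions_def split: if_splits)
  qed
  have "card (?P (insert s S) n) = card (?P S n) + (if s \<le> n then card (?P (insert s S) (n - s)) else 0)"
  proof (subst split, subst card_Un_disjoint)
    show "?P S n \<inter> (if s \<le> n then add_mset s ` ?P (insert s S) (n - s) else {}) = {}"
      using assms(1) by auto
    show "finite (if s \<le> n then add_mset s ` ?P (insert s S) (n - s) else {})"
      by (simp add: fin)
    have "inj_on (add_mset s) C" for C by (simp add: inj_on_def)
    then show "card (?P S n) + card (if s \<le> n then add_mset s ` ?P (insert s S) (n - s) else {})
        = card (?P S n) + (if s \<le> n then card (?P (insert s S) (n - s)) else 0)"
      by (simp add: card_image)
  qed (rule fin)
  then have "(of_nat (card (?P (insert s S) n)) :: 'a)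
     = of_nat (card (?P S n)) + (if s \<le> n then of_nat (card (?P (insert s S) (n - s))) else 0)"
    by simp
  then show "(partition_gf (insert s S) * (1 - fps_X ^ s)) $ n = (partition_gf S :: 'a fps) $ n"
    by (simp add: partition_gf_def right_diff_distrib fps_X_power_mult_right_nth not_le split: if_splits)
qed

lemma partition_gf_product:
  assumes "finite S" and "\<And>s. s \<in> S \<Longrightarrow> 1 \<le> s"
  shows "partition_gf S * (\<Prod>s\<in>S. 1 - fps_X ^ s) = (1 :: 'a::comm_ring_1 fps)"
  using assms
proof (induction S)
  case empty
  have "{p \<in> partitions n. set_mset p \<subseteq> {}} = (if n = 0 then {{#}} else {})" for n
    by (auto simp: partitions_def)
  then show ?case
    by (intro fps_ext) (simp add: partition_gf_def del: subset_empty)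
next
  case (insert s S)
  have "partition_gf (insert s S) * (\<Prod>s\<in>insert s S. 1 - fps_X ^ s)
      = (partition_gf (insert s S) * (1 - fps_X ^ s)) * (\<Prod>s\<in>S. 1 - fps_X ^ s :: 'a fps)"
    using insert.hyps by (simp add: mult_ac)
  also have "\<dots> = 1"
    using insert by (simp add: partition_gf_insert)
  finally show ?case .
qed

section \<open>Gordon partitions above a threshold\<close>

text \<open>
  The strict bounds make the class \<open>i = 0\<close> empty, which starts the recurrence in \<open>i\<close>.
\<close>

definition gordon_partitions :: "nat \<Rightarrow> nat \<Rightarrow> nat \<Rightarrow> nat \<Rightarrow> nat multiset set" where
  "gordon_partitions k i N n = {p \<in> partitions n. (\<forall>m\<in>#p. N < m) \<and> count p (Suc N) < i \<and>
     (\<forall>j\<ge>1. count p j + count p (Suc j) < k)}"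

definition gordon_gf :: "nat \<Rightarrow> nat \<Rightarrow> nat \<Rightarrow> rat fps" where
  "gordon_gf k i N = Abs_fps (\<lambda>n. of_nat (card (gordon_partitions k i N n)))"

lemma finite_gordon_partitions: "finite (gordon_partitions k i N n)"
  unfolding gordon_partitions_def using finite_partitions by simp

text \<open>
  The new partitions are those with exactly \<open>i\<close> copies of \<open>N + 1\<close>. Without these copies they are
  Gordon partitions above \<open>N + 1\<close>, and the bound \<open>k\<close> on the occurrences of \<open>N + 1\<close> and \<open>N + 2\<close>
  together leaves fewer than \<open>k - i\<close> copies of \<open>N + 2\<close>.
\<close>

lemma gordon_partitions_Suc:
  assumes "i < k"
  shows "gordon_partitions k (Suc i) N n = gordon_partitions k i N n \<union>
    (if i * Suc N \<le> n
     then (\<lambda>p. p + replicate_mset i (Suc N)) ` gordon_partitions k (k - i) (Suc N) (n - i * Suc N)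
     else {})" (is "?L = ?R1 \<union> ?R2")
proof (intro equalityI subsetI)
  fix p assume p: "p \<in> ?L"
  show "p \<in> ?R1 \<union> ?R2"
  proof (cases "count p (Suc N) = i")
    case True
    define p' where "p' = filter_mset (\<lambda>m. m \<noteq> Suc N) p"
    have p_eq: "p = p' + replicate_mset i (Suc N)"
      using True by (intro multiset_eqI) (auto simp: p'_def)
    have sum: "sum_mset p' + i * Suc N = n"
      using p unfolding p_eq by (simp add: gordon_partitions_def partitions_def)
    have "p' \<in> gordon_partitions k (k - i) (Suc N) (n - i * Suc N)"
      unfolding gordon_partitions_def partitions_def mem_Collect_eq
    proof (intro conjI allI ballI impI)
      fix m assume "m \<in># p'"
      then have "m \<in># p" "m \<noteq> Suc N" by (auto simp: p'_def)
      then show "1 \<le> m" "Suc N < m"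
        using p by (auto simp: gordon_partitions_def partitions_def order.strict_iff_order)
    next
      show "sum_mset p' = n - i * Suc N" using sum by simp
      have "count p (Suc N) + count p (Suc (Suc N)) < k"
        using p by (simp add: gordon_partitions_def)
      then show "count p' (Suc (Suc N)) < k - i"
        using True by (simp add: p'_def)
    next
      fix j :: nat assume "1 \<le> j"
      then have "count p j + count p (Suc j) < k"
        using p by (simp add: gordon_partitions_def)
      then show "count p' j + count p' (Suc j) < k"
        by (auto simp: p'_def)
    qed
    then have "p \<in> ?R2" using sum p_eq by auto
    then show ?thesis by blast
  next
    case False
    then show ?thesis using p by (auto simp: gordon_partitions_def)
  qed
next
  fix p assume "p \<in> ?R1 \<union> ?R2"
  then show "p \<in> ?L"
  proof
    assume "p \<in> ?R1"
    then show ?thesis by (simp add: gordon_partitions_def)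
  next
    assume "p \<in> ?R2"
    then obtain p' where le: "i * Suc N \<le> n" and p_eq: "p = p' + replicate_mset i (Suc N)"
      and p': "p' \<in> gordon_partitions k (k - i) (Suc N) (n - i * Suc N)"
      by (auto split: if_splits)
    have small: "count p' m = 0" if "m \<le> Suc N" for m
    proof -
      have "m \<notin># p'" using p' that by (auto simp: gordon_partitions_def)
      then show ?thesis by (simp add: not_in_iff)
    qed
    show ?thesis
      unfolding gordon_partitions_def partitions_def mem_Collect_eq
    proof (intro conjI allI ballI impI)
      fix m assume "m \<in># p"
      then have "m \<in># p' \<or> m = Suc N" by (auto simp: p_eq split: if_splits)
      then show "1 \<le> m" "N < m"
        using p' by (auto simp: gordon_partitions_def)
    next
      show "sum_mset p = n"
        using p' le by (simp add: p_eq gordon_partitions_def partitions_def)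
      show "count p (Suc N) < Suc i"
        using small by (simp add: p_eq)
    next
      fix j :: nat assume "1 \<le> j"
      then have 1: "count p' j + count p' (Suc j) < k"
        using p' by (simp add: gordon_partitions_def)
      have 2: "count p' (Suc (Suc N)) < k - i"
        using p' by (simp add: gordon_partitions_def)
      consider "j = N" | "j = Suc N" | "j \<noteq> N" "j \<noteq> Suc N" by blast
      then show "count p j + count p (Suc j) < k"
        using 1 2 small[of N] small[of "Suc N"] assms by cases (auto simp: p_eq)
    qed
  qed
qed

lemma gordon_gf_Suc:
  assumes "i < k"
  shows "gordon_gf k (Suc i) N = gordon_gf k i N + fps_X ^ (i * Suc N) * gordon_gf k (k - i) (Suc N)"
proof (rule fps_ext)
  fix n
  let ?R2 = "if i * Suc N \<le> n
     then (\<lambda>p. p + replicate_mset i (Suc N)) ` gordon_partitions k (k - i) (Suc N) (n - i * Suc N)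
     else {}"
  have *: "count p (Suc N) = i" if pR: "p \<in> ?R2" for p
  proof -
    obtain p' where p: "p = p' + replicate_mset i (Suc N)"
      and "p' \<in> gordon_partitions k (k - i) (Suc N) (n - i * Suc N)"
      using pR by (auto split: if_splits)
    then have "Suc N \<notin># p'" by (auto simp: gordon_partitions_def)
    then show ?thesis by (simp add: p not_in_iff)
  qed
  have "gordon_partitions k i N n \<inter> ?R2 = {}"
    using * by (fastforce simp: gordon_partitions_def)
  then have "card (gordon_partitions k (Suc i) N n) = card (gordon_partitions k i N n) + card ?R2"
    unfolding gordon_partitions_Suc[OF assms]
    by (intro card_Un_disjoint) (auto simp: finite_gordon_partitions)
  also have "card ?R2 = (if i * Suc N \<le> n
      then card (gordon_partitions k (k - i) (Suc N) (n - i * Suc N)) else 0)"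
    by (auto intro!: card_image simp: inj_on_def)
  finally show "gordon_gf k (Suc i) N $ n
      = (gordon_gf k i N + fps_X ^ (i * Suc N) * gordon_gf k (k - i) (Suc N)) $ n"
    by (simp add: gordon_gf_def fps_X_power_mult_nth not_le split: if_splits)
qed

lemma gordon_gf_0: "gordon_gf k 0 N = 0"
  by (intro fps_ext) (simp add: gordon_gf_def gordon_partitions_def)

text \<open>
  Below \<open>X ^ M\<close> only the empty partition counts, since every part exceeds \<open>N \<ge> M\<close>.
\<close>

lemma gordon_gf_large:
  assumes "1 \<le> i" and "i \<le> k" and "M \<le> N"
  shows "agree M (gordon_gf k i N) 1"
  unfolding agree_def
proof (intro allI impI)
  fix n assume "n < M"
  have "gordon_partitions k i N n = (if n = 0 then {{#}} else {})"
  proof (intro equalityI subsetI)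
    fix p assume p: "p \<in> gordon_partitions k i N n"
    have "p = {#}"
    proof (rule ccontr)
      assume "p \<noteq> {#}"
      then obtain m p' where m: "p = add_mset m p'" by (meson multiset_cases)
      then have "N < m" "m \<le> n" using p by (auto simp: gordon_partitions_def partitions_def)
      then show False using \<open>n < M\<close> assms(3) by simp
    qed
    then show "p \<in> (if n = 0 then {{#}} else {})"
      using p by (auto simp: gordon_partitions_def partitions_def)
  next
    fix p assume "p \<in> (if n = 0 then {{#}} else {} :: nat multiset set)"
    then show "p \<in> gordon_partitions k i N n"
      using assms by (auto simp: gordon_partitions_def partitions_def split: if_splits)
  qed
  then show "gordon_gf k i N $ n = 1 $ n" by (simp add: gordon_gf_def)
qed

section \<open>Alternating sums with the same recurrence\<close>

text \<open>
  The \<open>n\<close>-th summand of Andrews' \<open>J\<^sub>k\<^sub>,\<^sub>i(0; x; q)\<close> at \<open>q = X\<close> and \<open>x = X ^ N\<close>, multiplied by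
  \<open>(q; q)\<^sub>\<infinity>\<close>. The usual denominator \<open>(q; q)\<^sub>n (x q\<^sup>n\<^sup>+\<^sup>1; q)\<^sub>\<infinity>\<close> thereby becomes the product of the
  \<open>1 - X ^ (n + r)\<close> for \<open>r = 1, \<dots>, N\<close>, so that every summand is a polynomial.
\<close>

definition gordon_term :: "nat \<Rightarrow> nat \<Rightarrow> nat \<Rightarrow> nat \<Rightarrow> 'a::comm_ring_1 fps" where
  "gordon_term k i N n = (-1) ^ n * fps_X ^ (n * (N * k + k * n + (k - i)) + (Suc n choose 2))
     * (1 - fps_X ^ ((N + 2 * n + 1) * i)) * (\<Prod>r\<in>{1..N}. 1 - fps_X ^ (n + r))"

lemma gordon_term_0: "gordon_term k 0 N n = 0"
  by (simp add: gordon_term_def)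

text \<open>
  The difference of the summands for \<open>i + 1\<close> and \<open>i\<close> is \<open>u n + v n\<close>: the factor \<open>1 - X ^ n\<close> of \<open>u n\<close>
  and the factor \<open>1 - X ^ (N + n + 1)\<close> hidden in \<open>v n\<close> extend the product over \<open>r\<close> to length \<open>N + 1\<close>,
  at \<open>n - 1\<close> and at \<open>n\<close> respectively. Regrouping \<open>v n\<close> with \<open>u (n + 1)\<close> yields the
  summand for the threshold \<open>N + 1\<close>. The sums differ by the boundary terms: \<open>u 0 = 0\<close>, and
  \<open>u L\<close> is divisible by \<open>X ^ L\<close>, which is why the identity holds only up to that order.
\<close>

lemma gordon_sum_Suc:
  assumes "i < k"
  shows "agree L (\<Sum>n<L. gordon_term k (Suc i) N n)
    ((\<Sum>n<L. gordon_term k i N n)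
      + fps_X ^ (i * Suc N) * (\<Sum>n<L. gordon_term k (k - i) (Suc N) n) :: 'a::comm_ring_1 fps)"
proof -
  obtain c where k: "k = Suc (i + c)" using assms less_imp_Suc_add by auto
  have tri: "(Suc n choose 2) = (n choose 2) + n" for n by (simp add: numeral_2_eq_2)
  define P where "P n = (\<Prod>r\<in>{1..Suc N}. 1 - fps_X ^ (n + r) :: 'a fps)" for n
  define u where "u n = (-1) ^ n * fps_X ^ (n * (N * k + k * n + c) + (Suc n choose 2))
      * (1 - fps_X ^ n) * (\<Prod>r\<in>{1..N}. 1 - fps_X ^ (n + r) :: 'a fps)" for n
  define v where "v n = (-1) ^ n * fps_X ^ (n * (N * k + k * n + Suc c) + (Suc n choose 2) + (N + 2 * n + 1) * i)
      * P n" for n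
  have P1: "(\<Prod>r\<in>{1..N}. 1 - fps_X ^ (n + r)) * (1 - fps_X ^ (N + n + 1)) = P n" for n
    by (simp add: P_def add_ac)
  have P2: "(1 - fps_X ^ Suc n) * (\<Prod>r\<in>{1..N}. 1 - fps_X ^ (Suc n + r)) = P n" for n
    unfolding P_def One_nat_def prod.atLeast1_atMost_eq
    by (subst prod.lessThan_Suc_shift) simp
  \<comment> \<open>In \<open>X ^ (n * c) * (1 - X ^ ((N + 2 * n + 1) * (i + 1))) - X ^ (n * (c + 1)) * (1 - X ^ ((N + 2 * n + 1) * i))\<close>,
    the first powers combine to \<open>u\<close> and the others to \<open>v\<close>.\<close>
  have difference: "gordon_term k (Suc i) N n - gordon_term k i N n = u n + v n" for n
  proof -
    define E where "E = n * (N * k + k * n + c) + (Suc n choose 2)"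
    let ?s = "(-1) ^ n :: 'a fps" and ?R = "\<Prod>r\<in>{1..N}. 1 - fps_X ^ (n + r) :: 'a fps"
    have "gordon_term k (Suc i) N n = ?s * fps_X ^ E * (1 - fps_X ^ ((N + 2 * n + 1) * i + (N + n + 1) + n)) * ?R"
      by (simp add: gordon_term_def E_def k algebra_simps)
    moreover have "gordon_term k i N n = ?s * fps_X ^ (E + n) * (1 - fps_X ^ ((N + 2 * n + 1) * i)) * ?R"
      by (simp add: gordon_term_def E_def k algebra_simps)
    moreover have "v n = ?s * fps_X ^ (E + n + (N + 2 * n + 1) * i) * (?R * (1 - fps_X ^ (N + n + 1)))"
      unfolding P1 by (simp add: v_def E_def algebra_simps)
    moreover have "u n = ?s * fps_X ^ E * (1 - fps_X ^ n) * ?R"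
      by (simp add: u_def E_def)
    ultimately show ?thesis
      by (simp only: power_add ring_distribs) (simp add: algebra_simps)
  qed
  have shifted: "u (Suc n) + v n = fps_X ^ (i * Suc N) * gordon_term k (k - i) (Suc N) n" for n
  proof -
    define E where "E = i * Suc N + (n * (Suc N * k + k * n + i) + (Suc n choose 2))"
    have "u (Suc n) = - ((-1) ^ n * fps_X ^ (E + (Suc N + 2 * n + 1) * (k - i)) * P n)"
    proof -
      have "Suc n * (N * k + k * Suc n + c) + (Suc (Suc n) choose 2) = E + (Suc N + 2 * n + 1) * (k - i)"
        unfolding tri[of "Suc n"] E_def k by (simp add: algebra_simps)
      then show ?thesis unfolding u_def P2[symmetric] by (simp only: power_Suc mult_ac) simp
    qed
    moreover have "v n = (-1) ^ n * fps_X ^ E * P n"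
    proof -
      have "n * (N * k + k * n + Suc c) + (Suc n choose 2) + (N + 2 * n + 1) * i = E"
        unfolding E_def k by (simp add: algebra_simps)
      then show ?thesis unfolding v_def by simp
    qed
    moreover have "fps_X ^ (i * Suc N) * gordon_term k (k - i) (Suc N) n
        = (-1) ^ n * fps_X ^ E * (1 - fps_X ^ ((Suc N + 2 * n + 1) * (k - i))) * P n"
    proof -
      have "k - (k - i) = i" using assms by simp
      then show ?thesis
        unfolding gordon_term_def E_def P_def[symmetric] power_add[of _ "i * Suc N"] by (simp only: mult_ac)
    qed
    ultimately show ?thesis
      by (simp only: power_add ring_distribs) (simp add: algebra_simps)
  qed
  have u0: "u 0 = 0" by (simp add: u_def)
  have uL: "agree L (u L) 0"
  proof -
    have "L \<le> L * (N * k + k * L + c) + (Suc L choose 2)" by (simp add: tri)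
    then have "agree L (fps_X ^ (L * (N * k + k * L + c) + (Suc L choose 2))
        * ((-1) ^ L * (1 - fps_X ^ L) * (\<Prod>r\<in>{1..N}. 1 - fps_X ^ (L + r) :: 'a fps))) 0"
      by (rule agree_X_power_mult_0)
    then show ?thesis unfolding u_def by (simp only: mult_ac)
  qed
  have telescope: "(\<Sum>n<L. u (Suc n)) = (\<Sum>n<L. u n) + u L"
    using sum.lessThan_Suc_shift[of u L] u0 by simp
  have "(\<Sum>n<L. gordon_term k (Suc i) N n) - (\<Sum>n<L. gordon_term k i N n) = (\<Sum>n<L. u n) + (\<Sum>n<L. v n)"
    by (simp only: sum_subtractf[symmetric] difference sum.distrib)
  moreover have "fps_X ^ (i * Suc N) * (\<Sum>n<L. gordon_term k (k - i) (Suc N) n) = (\<Sum>n<L. u n) + u L + (\<Sum>n<L. v n)"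
    by (simp only: sum_distrib_left shifted[symmetric] sum.distrib telescope)
  ultimately have "(\<Sum>n<L. gordon_term k i N n)
      + fps_X ^ (i * Suc N) * (\<Sum>n<L. gordon_term k (k - i) (Suc N) n)
      = (\<Sum>n<L. gordon_term k (Suc i) N n) + u L"
    by (simp add: algebra_simps)
  then show ?thesis
    using agree_add[OF agree_refl agree_sym[OF uL], of "\<Sum>n<L. gordon_term k (Suc i) N n"] by simp
qed

text \<open>
  If \<open>N \<ge> M\<close>, all summands with \<open>n \<ge> 1\<close> are divisible by \<open>X ^ (N * k)\<close>, and the summand with
  \<open>n = 0\<close> differs from the product of the \<open>1 - X ^ r\<close> only in coefficients from \<open>X ^ M\<close> on.
\<close>

lemma gordon_sum_large:
  assumes "1 \<le> i" and "i \<le> k" and "M \<le> N"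
  shows "agree M (\<Sum>n<M. gordon_term k i N n) (q_fact fps_X M :: 'a::comm_ring_1 fps)"
proof (cases M)
  case 0
  then show ?thesis by (simp add: agree_def)
next
  case (Suc M')
  have "agree M (gordon_term k i N (Suc n)) (0 :: 'a fps)" for n
  proof -
    have "M \<le> N * k" using assms by (cases k) auto
    then have "M \<le> Suc n * (N * k + k * Suc n + (k - i)) + (Suc (Suc n) choose 2)"
      by (simp add: trans_le_add1)
    then have "agree M (fps_X ^ (Suc n * (N * k + k * Suc n + (k - i)) + (Suc (Suc n) choose 2))
        * ((-1) ^ Suc n * (1 - fps_X ^ ((N + 2 * Suc n + 1) * i)) * (\<Prod>r\<in>{1..N}. 1 - fps_X ^ (Suc n + r))))
        (0 :: 'a fps)"
      by (rule agree_X_power_mult_0)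
    then show ?thesis unfolding gordon_term_def by (simp only: mult_ac)
  qed
  then have "agree M (\<Sum>n<M'. gordon_term k i N (Suc n)) (\<Sum>n<M'. 0 :: 'a fps)"
    by (intro agree_sum)
  then have "agree M (gordon_term k i N 0 + (\<Sum>n<M'. gordon_term k i N (Suc n))) (gordon_term k i N 0 + (\<Sum>n<M'. 0 :: 'a fps))"
    by (rule agree_add[OF agree_refl])
  then have 1: "agree M (\<Sum>n<M. gordon_term k i N n) (gordon_term k i N 0 :: 'a fps)"
    unfolding Suc sum.lessThan_Suc_shift by simp
  have "M \<le> (N + 1) * i" using assms by (cases i) auto
  then have "agree M (fps_X ^ ((N + 1) * i) * 1) (0 :: 'a fps)" by (rule agree_X_power_mult_0)
  then have "agree M (1 - fps_X ^ ((N + 1) * i)) (1 - 0 :: 'a fps)" by (intro agree_diff) auto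
  moreover have "agree M (\<Prod>r\<in>{1..N}. 1 - fps_X ^ r) (\<Prod>r\<in>{1..M}. 1 - fps_X ^ r :: 'a fps)"
    using assms by (intro agree_prod_one_minus_X_power) auto
  ultimately have "agree M ((1 - fps_X ^ ((N + 1) * i)) * (\<Prod>r\<in>{1..N}. 1 - fps_X ^ r))
      ((1 - 0) * (\<Prod>r\<in>{1..M}. 1 - fps_X ^ r :: 'a fps))"
    by (rule agree_mult)
  then have "agree M (gordon_term k i N 0) (q_fact fps_X M :: 'a fps)"
    by (simp add: gordon_term_def q_fact_def binomial_eq_0)
  then show ?thesis using 1 by (rule agree_trans[rotated])
qed

text \<open>
  At threshold \<open>0\<close> the summands are, in pairs, those of Jacobi's theta series with base
  \<open>X ^ (2 * k + 1)\<close>, in the form in which \<open>jacobi_triple_product_agree\<close> gives it.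
\<close>

lemma gordon_term_threshold_0:
  assumes "i \<le> k"
  shows "gordon_term k i 0 n
    = (-1) ^ n * ((fps_X ^ (2 * k + 1)) ^ (n choose 2) * (fps_X ^ (2 * k + 1 - i)) ^ n
        - (fps_X ^ (2 * k + 1)) ^ (Suc n choose 2) * (fps_X ^ i) ^ Suc n :: 'a::comm_ring_1 fps)"
proof -
  obtain c where k: "k = i + c" using assms by (auto simp: le_iff_add)
  have tri: "(Suc n choose 2) = (n choose 2) + n" by (simp add: numeral_2_eq_2)
  have tri2: "2 * (n choose 2) + n = n * n"
    by (induction n) (auto simp: numeral_2_eq_2 binomial_eq_0)
  have sq: "n * n * k = 2 * (n choose 2) * k + n * k"
    by (simp only: tri2[symmetric] add_mult_distrib)
  let ?e = "n * (k * n + (k - i)) + (Suc n choose 2)"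
  have 1: "?e = (2 * k + 1) * (n choose 2) + (2 * k + 1 - i) * n"
    using sq unfolding tri by (simp add: k algebra_simps)
  have 2: "?e + (2 * n + 1) * i = (2 * k + 1) * (Suc n choose 2) + i * Suc n"
    using sq unfolding tri by (simp add: k algebra_simps)
  have "gordon_term k i 0 n = (-1) ^ n * (fps_X ^ ?e - fps_X ^ (?e + (2 * n + 1) * i) :: 'a fps)"
    by (simp add: gordon_term_def power_add right_diff_distrib mult_ac)
  then show ?thesis unfolding 2 unfolding 1 by (simp only: power_add power_mult)
qed

text \<open>
  Both sides satisfy the same recurrence, which expresses the class \<open>i + 1\<close> at threshold \<open>N\<close> by the
  class \<open>i\<close> at \<open>N\<close> and the class \<open>k - i\<close> at \<open>N + 1\<close>. Both vanish for \<open>i = 0\<close>, and they agree for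
  \<open>N \<ge> M\<close>. Hence the outer induction descends in \<open>N\<close> and the inner one ascends in \<open>i\<close>.
\<close>

lemma gordon_gf_agree:
  assumes "i \<le> k"
  shows "agree M (q_fact fps_X M * gordon_gf k i N) (\<Sum>n<M. gordon_term k i N n)"
  using assms
proof (induction "M - N" arbitrary: N i)
  case 0
  show ?case
  proof (cases "i = 0")
    case False
    have "agree M (q_fact fps_X M * gordon_gf k i N) (q_fact fps_X M * 1)"
      using 0 False by (intro agree_mult agree_refl gordon_gf_large) auto
    also have "agree M (q_fact fps_X M * 1) (\<Sum>n<M. gordon_term k i N n)"
      unfolding mult_1_right using 0 False by (intro agree_sym[OF gordon_sum_large]) auto
    finally show ?thesis .
  qed (simp add: gordon_gf_0 gordon_term_0)
next
  case (Suc t)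
  let ?q = "q_fact fps_X M :: rat fps"
  from \<open>i \<le> k\<close> show ?case
  proof (induction i)
    case 0
    show ?case by (simp add: gordon_gf_0 gordon_term_0)
  next
    case (Suc i)
    have 1: "agree M (?q * gordon_gf k i N) (\<Sum>n<M. gordon_term k i N n)"
      using Suc by simp
    have "agree M (?q * gordon_gf k (k - i) (Suc N)) (\<Sum>n<M. gordon_term k (k - i) (Suc N) n)"
      using Suc.hyps \<open>Suc t = M - N\<close> by (intro Suc.hyps) auto
    then have 2: "agree M (fps_X ^ (i * Suc N) * (?q * gordon_gf k (k - i) (Suc N)))
        (fps_X ^ (i * Suc N) * (\<Sum>n<M. gordon_term k (k - i) (Suc N) n))"
      by (rule agree_mult[OF agree_refl])
    have "?q * gordon_gf k (Suc i) N
        = ?q * gordon_gf k i N + fps_X ^ (i * Suc N) * (?q * gordon_gf k (k - i) (Suc N))"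
      using Suc.prems by (simp add: gordon_gf_Suc algebra_simps)
    then show ?case
      using agree_trans[OF agree_add[OF 1 2] agree_sym[OF gordon_sum_Suc]] Suc.prems by simp
  qed
qed

section \<open>Gordon's theorem\<close>

definition excluded_residue :: "nat \<Rightarrow> nat \<Rightarrow> nat \<Rightarrow> bool" where
  "excluded_residue m i s \<longleftrightarrow>
     [int s = 0] (mod int m) \<or> [int s = int i] (mod int m) \<or> [int s = - int i] (mod int m)"

lemma excluded_residue_iff:
  assumes "0 < i" and "i < m"
  shows "excluded_residue m i s \<longleftrightarrow> s mod m \<in> {0, i, m - i}"
proof -
  have "[int s = 0] (mod int m) \<longleftrightarrow> s mod m = 0"
    by (simp add: cong_0_iff mod_eq_0_iff_dvd)
  moreover have "[int s = int i] (mod int m) \<longleftrightarrow> s mod m = i"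
    using assms unfolding cong_int_iff by (simp add: cong_def)
  moreover have "[int s = - int i] (mod int m) \<longleftrightarrow> s mod m = m - i"
  proof -
    have "[int s = - int i] (mod int m) \<longleftrightarrow> int m dvd int (s + i)"
      by (simp add: cong_iff_dvd_diff)
    also have "\<dots> \<longleftrightarrow> (s mod m + i) mod m = 0"
      unfolding of_nat_dvd_iff by (simp only: dvd_eq_mod_eq_0 mod_add_left_eq)
    also have "\<dots> \<longleftrightarrow> s mod m = m - i"
    proof -
      have less: "s mod m < m" using assms by simp
      show ?thesis
      proof (cases "s mod m + i < m")
        case True
        then show ?thesis using assms(1) by (simp only: mod_less) linarith
      next
        case False
        then have "(s mod m + i) mod m = (s mod m + i - m) mod m"
          by (intro le_mod_geq) simp
        also have "\<dots> = s mod m + i - m"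
          using less assms by (intro mod_less) linarith
        finally show ?thesis using False less assms by linarith
      qed
    qed
    finally show ?thesis .
  qed
  ultimately show ?thesis by (simp add: excluded_residue_def)
qed

text \<open>
  The three products in the triple product with \<open>a = 2 * k + 1 - i\<close> and \<open>b = i\<close> run through the three
  excluded residue classes. These are distinct because \<open>1 \<le> i \<le> k\<close>, so they form a single product
  without repetition.
\<close>

lemma excluded_residue_product_agree:
  assumes "1 \<le> i" and "i \<le> k"
  shows "agree M (\<Prod>s\<in>{s \<in> {1..<M}. excluded_residue (2 * k + 1) i s}. 1 - fps_X ^ s)
    (\<Sum>n<M. gordon_term k i 0 n :: 'a::field fps)"
proof -
  define m where "m = 2 * k + 1"
  define a where "a = m - i"
  have m: "0 < i" "i < m" "a + i = m" "0 < a" "a < m" "a \<noteq> i"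
    using assms by (auto simp: m_def a_def)
  define U V W where "U = (\<lambda>r. m * r) ` {1..M}" and "V = (\<lambda>j. a + m * j) ` {..<M}"
    and "W = (\<lambda>j. i + m * j) ` {..<M}"
  have res: "s \<in> U \<Longrightarrow> s mod m = 0" "s \<in> V \<Longrightarrow> s mod m = a" "s \<in> W \<Longrightarrow> s mod m = i" for s
    using m by (auto simp: U_def V_def W_def)
  have pos: "s \<in> U \<union> V \<union> W \<Longrightarrow> 1 \<le> s" for s
    using m by (auto simp: U_def V_def W_def)
  have cover: "s \<in> U \<union> V \<union> W" if "1 \<le> s" "s < M" "s mod m \<in> {0, i, a}" for s
  proof -
    define r t where "r = s mod m" and "t = s div m"
    have s: "s = r + m * t" by (simp add: r_def t_def)
    have "t < M" using that(2) unfolding t_def by (meson div_le_dividend le_less_trans)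
    have "r = 0 \<or> r = i \<or> r = a" using that(3) by (simp add: r_def)
    then consider "r = 0" | "r = i" | "r = a" by blast
    then show ?thesis
    proof cases
      case 1
      then have "t \<in> {1..M}" using s that(1) \<open>t < M\<close> by (cases t) auto
      then show ?thesis using s 1 by (auto simp: U_def)
    qed (use s \<open>t < M\<close> in \<open>auto simp: V_def W_def\<close>)
  qed
  have fin: "finite U" "finite V" "finite W" by (simp_all add: U_def V_def W_def)
  have disj: "U \<inter> V = {}" "(U \<union> V) \<inter> W = {}"
    unfolding disjoint_iff using res m(1,4,6) by (metis less_irrefl, metis UnE less_irrefl)
  define Q where "Q = (fps_X ^ m :: 'a fps)"
  have "q_fact Q M = (\<Prod>s\<in>U. 1 - fps_X ^ s)"
    unfolding Q_def q_fact_X_power U_def using m by (subst prod.reindex) (auto simp: inj_on_def)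
  moreover have "(\<Prod>j<M. 1 - fps_X ^ a * Q ^ j) = (\<Prod>s\<in>V. 1 - fps_X ^ s)"
    unfolding Q_def V_def using m by (subst prod.reindex) (auto simp: inj_on_def power_add power_mult)
  moreover have "(\<Prod>j<M. 1 - fps_X ^ i * Q ^ j) = (\<Prod>s\<in>W. 1 - fps_X ^ s)"
    unfolding Q_def W_def using m by (subst prod.reindex) (auto simp: inj_on_def power_add power_mult)
  ultimately have "q_fact Q M * ((\<Prod>j<M. 1 - fps_X ^ a * Q ^ j) * (\<Prod>j<M. 1 - fps_X ^ i * Q ^ j))
      = (\<Prod>s\<in>U \<union> V \<union> W. 1 - fps_X ^ s)"
    using fin disj by (simp add: prod.union_disjoint mult.assoc)
  moreover have "agree M
    (q_fact Q M * ((\<Prod>j<M. 1 - fps_X ^ a * Q ^ j) * (\<Prod>j<M. 1 - fps_X ^ i * Q ^ j)))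
    (\<Sum>j<M. (-1) ^ j * (Q ^ (j choose 2) * (fps_X ^ a) ^ j - Q ^ (Suc j choose 2) * (fps_X ^ i) ^ Suc j))"
    using jacobi_triple_product_agree[of a M i, where 'a='a] m by (simp add: Q_def)
  ultimately have theta: "agree M (\<Prod>s\<in>U \<union> V \<union> W. 1 - fps_X ^ s) (\<Sum>n<M. gordon_term k i 0 n :: 'a fps)"
    unfolding gordon_term_threshold_0[OF assms(2)] Q_def a_def m_def by (simp only:)
  have "agree M (\<Prod>s\<in>U \<union> V \<union> W. 1 - fps_X ^ s :: 'a fps)
      (\<Prod>s\<in>{s \<in> {1..<M}. excluded_residue m i s}. 1 - fps_X ^ s)"
  proof (rule agree_prod_one_minus_X_power)
    show "{s \<in> {1..<M}. excluded_residue m i s} \<subseteq> U \<union> V \<union> W"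
    proof
      fix s assume s: "s \<in> {s \<in> {1..<M}. excluded_residue m i s}"
      then have "s mod m \<in> {0, i, a}" using m(1,2) by (simp add: excluded_residue_iff a_def)
      then show "s \<in> U \<union> V \<union> W" using s by (intro cover) auto
    qed
    fix s assume s: "s \<in> U \<union> V \<union> W - {s \<in> {1..<M}. excluded_residue m i s}"
    then have "s mod m \<in> {0, i, a}" using res[of s] by blast
    then have "excluded_residue m i s" using m(1,2) by (simp add: excluded_residue_iff a_def)
    then show "M \<le> s" using s pos[of s] by (auto simp: not_less)
  qed (use fin in auto)
  from agree_trans[OF agree_sym[OF this] theta] show ?thesis by (simp only: m_def)
qed

text \<open>
  Multiplication by the product of all \<open>1 - X ^ s\<close> turns the generating function of the partitions
  into good parts into the product over the bad parts, which is the theta series. The generating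
  function of the Gordon partitions is turned into the same series, and the multiplier is invertible.
\<close>

lemma gordon_theorem:
  assumes "1 \<le> i" and "i \<le> k"
  shows "card {p \<in> partitions n. \<forall>s\<in>#p. \<not> excluded_residue (2 * k + 1) i s}
    = card (gordon_partitions k i 0 n)"
proof -
  let ?ex = "excluded_residue (2 * k + 1) i"
  define good bad where "good = {s \<in> {1..n}. \<not> ?ex s}" and "bad = {s \<in> {1..n}. ?ex s}"
  let ?q = "q_fact fps_X (Suc n) :: rat fps"
  have part: "partition_gf good * (\<Prod>s\<in>good. 1 - fps_X ^ s) = (1 :: rat fps)"
    by (rule partition_gf_product) (auto simp: good_def)
  have "agree (Suc n) ?q (\<Prod>s\<in>{1..n}. 1 - fps_X ^ s)"
    unfolding q_fact_def by (intro agree_prod_one_minus_X_power) auto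
  also have "{1..n} = good \<union> bad" by (auto simp: good_def bad_def)
  also have "(\<Prod>s\<in>good \<union> bad. 1 - fps_X ^ s) = (\<Prod>s\<in>good. 1 - fps_X ^ s) * (\<Prod>s\<in>bad. 1 - fps_X ^ s :: rat fps)"
    by (rule prod.union_disjoint) (auto simp: good_def bad_def)
  finally have "agree (Suc n) (?q * partition_gf good)
      ((\<Prod>s\<in>good. 1 - fps_X ^ s) * (\<Prod>s\<in>bad. 1 - fps_X ^ s) * partition_gf good)"
    by (rule agree_mult[OF _ agree_refl])
  also have "(\<Prod>s\<in>good. 1 - fps_X ^ s) * (\<Prod>s\<in>bad. 1 - fps_X ^ s) * partition_gf good
      = (\<Prod>s\<in>bad. 1 - fps_X ^ s :: rat fps)"
    using part by (simp add: mult_ac)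
  finally have 1: "agree (Suc n) (?q * partition_gf good) (\<Prod>s\<in>bad. 1 - fps_X ^ s)" .
  have "{1..<Suc n} = {1..n}" by auto
  then have 2: "agree (Suc n) (\<Prod>s\<in>bad. 1 - fps_X ^ s :: rat fps) (\<Sum>j<Suc n. gordon_term k i 0 j)"
    using excluded_residue_product_agree[OF assms, of "Suc n", where 'a=rat] by (simp only: bad_def)
  have "agree (Suc n) (?q * partition_gf good) (?q * gordon_gf k i 0)"
    using agree_trans[OF agree_trans[OF 1 2] agree_sym[OF gordon_gf_agree[OF assms(2)]]] .
  moreover have "?q $ 0 \<noteq> 0"
    unfolding q_fact_def by (subst prod_one_minus_X_power_nth_0) auto
  ultimately have "agree (Suc n) (partition_gf good) (gordon_gf k i 0)"
    by (rule agree_cancel)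
  then have "card {p \<in> partitions n. set_mset p \<subseteq> good} = card (gordon_partitions k i 0 n)"
    by (simp add: agree_def partition_gf_def gordon_gf_def)
  moreover have "{p \<in> partitions n. set_mset p \<subseteq> good} = {p \<in> partitions n. \<forall>s\<in>#p. \<not> ?ex s}"
  proof -
    have "s \<le> n" if "p \<in> partitions n" "s \<in># p" for p s
      using that by (auto simp: partitions_def dest!: multi_member_split)
    then show ?thesis by (auto simp: good_def partitions_def)
  qed
  ultimately show ?thesis by simp
qed

section \<open>Restricting to the multiples of a number\<close>

definition multiples_quotient :: "nat \<Rightarrow> nat multiset \<Rightarrow> nat multiset" where
  "multiples_quotient d p = image_mset (\<lambda>m. m div d) (filter_mset (\<lambda>m. d dvd m) p)"

text \<open>
  A partition is determined by its nonmultiples \<open>r\<close> of \<open>d\<close> and by \<open>multiples_quotient d p\<close>, which can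
  be chosen independently once the sums fit. The number of partitions with a property of
  \<open>multiples_quotient d p\<close> thus depends only on how many partitions of each size have the property.
\<close>

lemma card_quotient_decomposition:
  fixes d n :: nat and \<Phi> :: "nat multiset \<Rightarrow> bool"
  assumes d: "1 \<le> d"
  shows "card {p \<in> partitions n. \<Phi> (multiples_quotient d p)}
    = (\<Sum>r | (\<forall>m\<in>#r. \<not> d dvd m) \<and> sum_mset r \<le> n \<and> d dvd n - sum_mset r.
         card {p \<in> partitions ((n - sum_mset r) div d). \<Phi> p})"
proof -
  let ?R = "{r. (\<forall>m\<in>#r. \<not> d dvd m) \<and> sum_mset r \<le> n \<and> d dvd n - sum_mset r}"
  let ?S = "\<lambda>r. {p \<in> partitions ((n - sum_mset r) div d). \<Phi> p}"
  define glue where "glue = (\<lambda>(r, p). r + image_mset ((*) d) p)"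
  have finR: "finite ?R"
  proof (rule finite_subset)
    show "?R \<subseteq> (\<Union>s\<le>n. partitions s)"
    proof
      fix r assume "r \<in> ?R"
      moreover have "1 \<le> m" if "\<not> d dvd m" for m using that by (cases m) auto
      ultimately show "r \<in> (\<Union>s\<le>n. partitions s)" by (auto simp: partitions_def)
    qed
  qed (simp add: finite_partitions)
  have quot_glue: "multiples_quotient d (glue (r, p)) = p" "filter_mset (\<lambda>m. \<not> d dvd m) (glue (r, p)) = r"
    if "\<forall>m\<in>#r. \<not> d dvd m" for r p
  proof -
    have "filter_mset (\<lambda>m. d dvd m) r = {#}" using that by (induction r) auto
    then show "multiples_quotient d (glue (r, p)) = p"
      using d by (simp add: multiples_quotient_def glue_def filter_mset_image_mset multiset.map_comp comp_def)
    have "filter_mset (\<lambda>m. \<not> d dvd m) r = r" using that by (induction r) auto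
    then show "filter_mset (\<lambda>m. \<not> d dvd m) (glue (r, p)) = r"
      by (simp add: glue_def filter_mset_image_mset)
  qed
  have sum_glue: "sum_mset (glue (r, p)) = sum_mset r + d * sum_mset p" for r p
    by (induction p) (auto simp: glue_def algebra_simps)
  have glue_quot: "glue (filter_mset (\<lambda>m. \<not> d dvd m) p, multiples_quotient d p) = p" for p
  proof -
    have "image_mset ((*) d) (multiples_quotient d p) = filter_mset (\<lambda>m. d dvd m) p"
      unfolding multiples_quotient_def multiset.map_comp
      by (rule trans[OF image_mset_cong[of _ _ id]]) (auto simp: id_def)
    then show ?thesis by (simp add: glue_def add.commute)
  qed
  have "bij_betw glue (SIGMA r:?R. ?S r) {p \<in> partitions n. \<Phi> (multiples_quotient d p)}"
  proof (rule bij_betwI[where g = "\<lambda>p. (filter_mset (\<lambda>m. \<not> d dvd m) p, multiples_quotient d p)"])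
    show "glue \<in> (SIGMA r:?R. ?S r) \<rightarrow> {p \<in> partitions n. \<Phi> (multiples_quotient d p)}"
    proof
      fix x assume "x \<in> (SIGMA r:?R. ?S r)"
      then obtain r p where x: "x = (r, p)" and r: "\<forall>m\<in>#r. \<not> d dvd m" "sum_mset r \<le> n" "d dvd n - sum_mset r"
        and p: "p \<in> partitions ((n - sum_mset r) div d)" "\<Phi> p" by auto
      have "sum_mset (glue x) = n"
        using r p by (simp add: x sum_glue partitions_def)
      moreover have "1 \<le> m" if "m \<in># glue x" for m
      proof -
        have "m \<in># r \<or> (\<exists>m'\<in>#p. m = d * m')" using that by (auto simp: x glue_def)
        then show ?thesis using r(1) p(1) d by (cases m) (auto simp: partitions_def)
      qed
      ultimately show "glue x \<in> {p \<in> partitions n. \<Phi> (multiples_quotient d p)}"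
        using quot_glue(1)[OF r(1)] p by (simp add: x partitions_def)
    qed
    show "(\<lambda>p. (filter_mset (\<lambda>m. \<not> d dvd m) p, multiples_quotient d p))
        \<in> {p \<in> partitions n. \<Phi> (multiples_quotient d p)} \<rightarrow> (SIGMA r:?R. ?S r)"
    proof
      fix p assume p: "p \<in> {p \<in> partitions n. \<Phi> (multiples_quotient d p)}"
      let ?r = "filter_mset (\<lambda>m. \<not> d dvd m) p"
      have sum: "sum_mset ?r + d * sum_mset (multiples_quotient d p) = n"
        using p sum_glue[of ?r "multiples_quotient d p"] by (simp add: glue_quot partitions_def)
      then have "n - sum_mset ?r = d * sum_mset (multiples_quotient d p)" by linarith
      moreover have "1 \<le> m" if mq: "m \<in># multiples_quotient d p" for m
      proof -
        obtain m' where "m' \<in># p" "d dvd m'" "m = m' div d" using mq by (auto simp: multiples_quotient_def)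
        then show ?thesis using p d by (auto simp: partitions_def dvd_def)
      qed
      ultimately show "(?r, multiples_quotient d p) \<in> (SIGMA r:?R. ?S r)"
        using p sum d by (auto simp: partitions_def)
    qed
  qed (use quot_glue glue_quot in auto)
  then have "card {p \<in> partitions n. \<Phi> (multiples_quotient d p)} = card (SIGMA r:?R. ?S r)"
    by (simp add: bij_betw_same_card)
  also have "\<dots> = (\<Sum>r\<in>?R. card (?S r))"
    using finR by (intro card_SigmaI) (auto simp: finite_partitions)
  finally show ?thesis .
qed

lemma cong_mult_left_int_iff:
  fixes d a b m :: int
  assumes "d \<noteq> 0"
  shows "[d * a = d * b] (mod (d * m)) \<longleftrightarrow> [a = b] (mod m)"
  using assms by (simp add: cong_iff_dvd_diff flip: right_diff_distrib)

theorem theorem1p2: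
  fixes d k i n :: nat
  assumes "d \<ge> 1" and "1 \<le> i" and "i \<le> k"
  shows "A_count d k i n = B_count d k i n"
proof -
  let ?A = "\<lambda>p. \<forall>s\<in>#p. \<not> excluded_residue (2 * k + 1) i s"
  let ?B = "\<lambda>p. count p 1 < i \<and> (\<forall>j\<ge>1. count p j + count p (Suc j) < k)"
  \<comment> \<open>The modulus is \<open>d * (2 * k + 1)\<close>, so a forbidden residue occurs only at a multiple of \<open>d\<close>.\<close>
  have excl: "[int m = 0] (mod int (2 * d * k + d)) \<or> [int m = int (d * i)] (mod int (2 * d * k + d))
      \<or> [int m = - int (d * i)] (mod int (2 * d * k + d))
      \<longleftrightarrow> d dvd m \<and> excluded_residue (2 * k + 1) i (m div d)" for m
  proof -
    have modulus: "int (2 * d * k + d) = int d * int (2 * k + 1)" by (simp add: algebra_simps)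
    show ?thesis
    proof (cases "d dvd m")
      case True
      then obtain j where "m = d * j" ..
      then show ?thesis
        using assms(1) cong_mult_left_int_iff[of "int d" "int j" 0 "int (2 * k + 1)"]
          cong_mult_left_int_iff[of "int d" "int j" "int i" "int (2 * k + 1)"]
          cong_mult_left_int_iff[of "int d" "int j" "- int i" "int (2 * k + 1)"]
        unfolding modulus excluded_residue_def by simp
    next
      case False
      have "\<not> [int m = int d * c] (mod int d * int (2 * k + 1))" for c
      proof
        assume "[int m = int d * c] (mod int d * int (2 * k + 1))"
        then have "int d dvd int m - int d * c"
          by (auto simp: cong_iff_dvd_diff intro: dvd_mult_left)
        then have "int d dvd (int m - int d * c) + int d * c" by (rule dvd_add) simp
        with False show False by simp
      qed
      from this[of 0] this[of "int i"] this[of "- int i"] False show ?thesis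
        unfolding modulus by simp
    qed
  qed
  have count_quot: "count (multiples_quotient d p) j = count p (d * j)" for p j
    using assms(1) by (induction p) (auto simp: multiples_quotient_def)
  have "A_count d k i n = card {p \<in> partitions n. ?A (multiples_quotient d p)}"
    unfolding A_count_def using excl by (intro arg_cong[of _ _ card]) (auto simp: multiples_quotient_def)
  also have "\<dots> = card {p \<in> partitions n. ?B (multiples_quotient d p)}"
  proof -
    have "card {p \<in> partitions n. ?A p} = card {p \<in> partitions n. ?B p}" for n
    proof -
      have "gordon_partitions k i 0 n = {p \<in> partitions n. ?B p}"
        by (auto simp: gordon_partitions_def partitions_def Suc_le_eq)
      then show ?thesis using gordon_theorem[OF assms(2,3)] by simp
    qed
    then show ?thesis
      unfolding card_quotient_decomposition[OF assms(1), of n ?A]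
        card_quotient_decomposition[OF assms(1), of n ?B] by (intro sum.cong refl)
  qed
  also have "\<dots> = B_count d k i n"
    unfolding B_count_def using assms(2,3)
    by (intro arg_cong[of _ _ card]) (auto simp: count_quot less_Suc_eq_le[symmetric] add.commute)
  finally show ?thesis .
qed

end
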